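(* Let $d\ge 2$ and let $(\mathcal{D}_n)_{n\in\mathbb{N}}$ be a sequence of finite, non-empty subsets of $\mathbb{N}^d$ such that: (1) for every fixed $c\in\mathbb{Z}^d$, $\displaystyle\lim_{n\to\infty}\frac{\#((\mathcal{D}_n+c)\cap \mathcal{D}_n)}{\#\mathcal{D}_n}=1$; (2) there exists $K>0$ such that for all $i,j\in\{1,\ldots,d\}$ with $i\ne j$, all $a,b\in\mathbb{N}$ and all $n\in\mathbb{N}$, $\displaystyle\frac{\#(\mathcal{D}_n\cap \mathbb{Z}_i(a)\cap \mathbb{Z}_j(b))}{\#\mathcal{D}_n}\le\frac{K}{ab}$. For each $n\in\mathbb{N}$, let $(X_1^{(n)},\ldots,X_d^{(n)})$ be a random vector with the uniform distribution on $\mathcal{D}_n$. Then, as $n\to\infty$, in distribution, $$\gcd(X_1^{(n)},\ldots,X_d^{(n)})\ \longrightarrow\ \prod_{p\in\mathcal{P}}p^{\min_{k=1,\ldots,d}\mathcal{G}_k(p)},$$ and the limiting random variable has the distribution $$\mathbb{P}\left\{\prod_{p\in\mathcal{P}}p^{\min_{k=1,\ldots,d}\mathcal{G}_k(p)}=j\right\}=\frac{1}{\zeta(d)}\frac{1}{j^d},\quad j\in\mathbb{N},$$ where $\zeta$ is the Riemann zeta function.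
   Context: $\mathbb{N}=\{1,2,3,\ldots\}$, $\mathbb{N}_0=\mathbb{N}\cup\{0\}$, $\mathcal{P}$ is the set of primes, $\#$ denotes cardinality. For $i=1,\ldots,d$ and $a\in\mathbb{N}$, $\mathbb{Z}_i(a):=\{(x_1,\ldots,x_d)\in\mathbb{Z}^d: x_i\text{ is divisible by }a\}$. $(\mathcal{G}_1(p),\ldots,\mathcal{G}_d(p))_{p\in\mathcal{P}}$ is an array of mutually independent random variables with $\mathbb{P}\{\mathcal{G}_k(p)\ge j\}=p^{-j}$ for $j\in\mathbb{N}_0$, $p\in\mathcal{P}$, $k=1,\ldots,d$. *)

theory Defs
  imports "HOL-Probability.Probability" "HOL-Computational_Algebra.Primes"
begin

definition pos_lattice :: "(int ^ 'd) set" where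
  "pos_lattice = {x. \<forall>k. x $ k \<ge> 1}"

definition div_lattice :: "'d \<Rightarrow> nat \<Rightarrow> (int ^ 'd) set" where
  "div_lattice i a = {x. int a dvd x $ i}"

(* The Dirichlet series, which defines the Riemann zeta function for s > 1. *)
definition riemann_zeta :: "real \<Rightarrow> real" where
  "riemann_zeta s = (\<Sum>n. 1 / real (Suc n) powr s)"

definition gcd_vec :: "int ^ 'd \<Rightarrow> int" where
  "gcd_vec x = Gcd (range (\<lambda>k. x $ k))"

definition uniformly_distributed ::
    "'w measure \<Rightarrow> 'a set \<Rightarrow> ('w \<Rightarrow> 'a) \<Rightarrow> bool" where
  "uniformly_distributed \<Omega> A X \<longleftrightarrow>
     X \<in> measurable \<Omega> (count_space UNIV) \<and>
     distr \<Omega> (count_space UNIV) X = measure_pmf (pmf_of_set A)"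

definition prime_power_factor :: "('d::finite \<Rightarrow> nat \<Rightarrow> 'w \<Rightarrow> nat) \<Rightarrow> 'w \<Rightarrow> nat \<Rightarrow> real" where
  "prime_power_factor G \<omega> p = (if prime p then real p ^ (MIN k. G k p \<omega>) else 1)"

(* The product over all primes, as an infinite product over the natural numbers with
   factor 1 at the non-primes.  It converges at \<omega> iff only finitely many primes have
   a factor different from 1; elsewhere its value is an unspecified constant. *)
definition prime_product :: "('d::finite \<Rightarrow> nat \<Rightarrow> 'w \<Rightarrow> nat) \<Rightarrow> 'w \<Rightarrow> real" where
  "prime_product G \<omega> = (\<Prod>p. prime_power_factor G \<omega> p)"

definition (in prob_space) geometric_array :: "('d::finite \<Rightarrow> nat \<Rightarrow> 'a \<Rightarrow> nat) \<Rightarrow> bool" where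
  "geometric_array G \<longleftrightarrow>
     indep_vars (\<lambda>_. count_space UNIV) (\<lambda>(k, p). G k p) (UNIV \<times> {p. prime p}) \<and>
     (\<forall>k p j. prime p \<longrightarrow> prob {\<omega> \<in> space M. G k p \<omega> \<ge> j} = 1 / real p ^ j)"

end

theory Submission
  imports Defs
begin

text \<open>Both the gcd of a random vector from \<open>D n\<close> and the random product over primes are
  studied through their divisibility probabilities. Invariance of \<open>D n\<close> under shifts, up to a
  vanishing proportion, makes all residue classes modulo \<open>m\<close> asymptotically equally likely, so
  \<open>m\<close> divides the gcd with probability tending to \<open>m\<^sup>-\<^sup>d\<close> (lemma \<open>multiples_density\<close>). The
  divisibility hypothesis for two distinct coordinates bounds this probability by \<open>K / m\<^sup>2\<close>,
  uniformly in \<open>n\<close>. The random product is divisible by \<open>m\<close> with probability exactly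
  \<open>m\<^sup>-\<^sup>d\<close>, by independence and the geometric tails (lemma
  \<open>prob_geometric_array_ge_multiplicity\<close>).

  These facts determine the limits of the point masses (lemma \<open>zeta_law_limit\<close>). A positive
  number equals \<open>j\<close> if it is a multiple of \<open>j\<close> but of no \<open>j * p\<close> with \<open>p\<close> prime. Sieving by finitely
  many primes involves only finitely many divisibility events, and the remaining primes contribute
  a uniformly small error thanks to the quadratic bound. Hence the mass at \<open>j\<close> tends to
  \<open>C / j\<^sup>d\<close> with a constant \<open>C\<close> independent of \<open>j\<close>, and since the same bound prevents loss of
  mass, \<open>C = 1 / \<zeta>(d)\<close>. Applied to the gcds this gives their limit law; applied to the constant
  sequence of the law of the random product it gives the law of the product. The two coincide, and
  convergence of point masses on the natural numbers implies convergence in distribution.\<close>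

section \<open>Point masses from divisibility probabilities\<close>

text \<open>The numbers that survive the sieve by \<open>insert q S\<close> are the survivors of \<open>S\<close> among
  the multiples of \<open>m\<close>, minus the survivors of \<open>S\<close> among the multiples of \<open>m * q\<close>: for a
  multiple of \<open>m * q\<close> and a prime \<open>p \<noteq> q\<close>, divisibility by \<open>m * p\<close> and by
  \<open>m * q * p\<close> are equivalent. Induction on \<open>S\<close> therefore multiplies the limit by
  \<open>1 - q\<^sup>-\<^sup>d\<close> at each step. This is inclusion-exclusion in product form.\<close>

lemma sieved_multiples_limit:
  fixes Q :: "nat \<Rightarrow> nat measure" and d m :: nat
  assumes prob: "\<And>n. prob_space (Q n)" and sets_Q: "\<And>n. sets (Q n) = UNIV"
    and multiples: "\<And>m. m \<ge> 1 \<Longrightarrow> (\<lambda>n. measure (Q n) {g. m dvd g}) \<longlonglongrightarrow> 1 / real m ^ d"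
    and S: "finite S" "\<And>p. p \<in> S \<Longrightarrow> prime p" and m: "m \<ge> 1"
  shows "(\<lambda>n. measure (Q n) {g. m dvd g \<and> (\<forall>p\<in>S. \<not> m * p dvd g)})
           \<longlonglongrightarrow> (\<Prod>p\<in>S. 1 - 1 / real p ^ d) / real m ^ d"
  using S m
proof (induction S arbitrary: m rule: finite_induct)
  case empty
  then show ?case using multiples[of m] by simp
next
  case (insert q S)
  have q: "prime q" and S: "\<And>p. p \<in> S \<Longrightarrow> prime p" using insert.prems by auto
  have q1: "m * q \<ge> 1" using q insert.prems prime_gt_0_nat[of q] by simp
  define A where "A k = {g. k dvd g \<and> (\<forall>p\<in>S. \<not> k * p dvd g)}" for k
  have lcm_dvd: "m * q * p dvd g \<longleftrightarrow> m * p dvd g" if mq: "m * q dvd g" and p: "p \<in> S" for p g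
  proof
    assume "m * p dvd g"
    obtain h where h: "g = m * h" using dvd_mult_left[OF mq] by (auto elim: dvdE)
    have "coprime q p" using q S[OF p] p insert.hyps(2)
      by (auto intro: primes_coprime)
    moreover have "q dvd h" "p dvd h"
      using mq \<open>m * p dvd g\<close> insert.prems(2) unfolding h by auto
    ultimately have "q * p dvd h" by (simp add: divides_mult)
    then show "m * q * p dvd g" unfolding h by (simp add: mult.assoc)
  next
    assume "m * q * p dvd g"
    moreover have "m * p dvd m * q * p" by (intro mult_dvd_mono) auto
    ultimately show "m * p dvd g" by (rule dvd_trans[rotated])
  qed
  have weaken: "m dvd g" if "m * q dvd g" for g using that by (rule dvd_mult_left)
  have split: "{g. m dvd g \<and> (\<forall>p\<in>insert q S. \<not> m * p dvd g)} = A m - A (m * q)"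
    unfolding A_def using lcm_dvd weaken by blast
  have sub: "A (m * q) \<subseteq> A m"
    unfolding A_def using lcm_dvd weaken by blast
  have "(\<lambda>n. measure (Q n) (A m) - measure (Q n) (A (m * q)))
      \<longlonglongrightarrow> (\<Prod>p\<in>S. 1 - 1 / real p ^ d) / real m ^ d
          - (\<Prod>p\<in>S. 1 - 1 / real p ^ d) / real (m * q) ^ d"
    unfolding A_def using insert.IH[OF S insert.prems(2)] insert.IH[OF S q1]
    by (intro tendsto_diff) auto
  also have "(\<lambda>n. measure (Q n) (A m) - measure (Q n) (A (m * q)))
      = (\<lambda>n. measure (Q n) {g. m dvd g \<and> (\<forall>p\<in>insert q S. \<not> m * p dvd g)})"
    unfolding split
    by (intro ext finite_measure.finite_measure_Diff[symmetric] sub)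
       (auto simp: sets_Q prob prob_space.finite_measure)
  also have "(\<Prod>p\<in>S. 1 - 1 / real p ^ d) / real m ^ d
          - (\<Prod>p\<in>S. 1 - 1 / real p ^ d) / real (m * q) ^ d
      = (\<Prod>p\<in>insert q S. 1 - 1 / real p ^ d) / real m ^ d"
    using insert.hyps q1 by (simp add: field_simps power_mult_distrib)
  finally show ?case .
qed

text \<open>A positive multiple of \<open>j\<close> other than \<open>j\<close> itself is a multiple of \<open>j * p\<close> for
  some prime \<open>p\<close>. If it survives the sieve by the primes up to \<open>N\<close>, then \<open>p > N\<close>, and the
  union bound over all integers above \<open>N\<close> suffices because the bounds \<open>K / m\<^sup>2\<close> are
  summable. The point of the estimate is that it depends on \<open>Q\<close> only through \<open>K\<close>.\<close>

lemma sieve_error: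
  fixes Q :: "nat measure" and K :: real
  assumes prob: "prob_space Q" and sets_Q: "sets Q = UNIV" and zero: "measure Q {0} = 0"
    and bound: "\<And>m. m \<ge> 1 \<Longrightarrow> measure Q {g. m dvd g} \<le> K / real m ^ 2"
    and j: "j \<ge> 1"
  shows "\<bar>measure Q {g. j dvd g \<and> (\<forall>p\<in>{p. prime p \<and> p \<le> N}. \<not> j * p dvd g)} - measure Q {j}\<bar>
           \<le> (\<Sum>i. K / real (Suc (i + N)) ^ 2)"
proof -
  interpret prob_space Q by fact
  define B where "B = {g. j dvd g \<and> (\<forall>p\<in>{p. prime p \<and> p \<le> N}. \<not> j * p dvd g)}"
  define T where "T i = {g. j * Suc (i + N) dvd g}" for i
  have "0 \<le> measure Q {g. 1 dvd g}" by simp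
  also have "\<dots> \<le> K" using bound[of 1] by simp
  finally have K: "K \<ge> 0" .
  have summ: "summable (\<lambda>i. K / real (Suc (i + N)) ^ 2)"
  proof -
    have "summable (\<lambda>i. inverse (real (i + Suc N) ^ 2))"
      by (rule summable_ignore_initial_segment) (rule inverse_power_summable, simp)
    then show ?thesis by (auto simp: divide_inverse intro!: summable_mult)
  qed
  have le: "measure Q (T i) \<le> K / real (Suc (i + N)) ^ 2" for i
  proof -
    have "measure Q (T i) \<le> K / real (j * Suc (i + N)) ^ 2"
      unfolding T_def using j by (intro bound) simp
    also have "\<dots> \<le> K / real (Suc (i + N)) ^ 2"
      using j K mult_le_mono1[of 1 j "Suc (i + N)"]
      by (intro frac_le power_mono of_nat_mono) (auto simp del: mult_Suc_right)
    finally show ?thesis .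
  qed
  have summ_T: "summable (\<lambda>i. measure Q (T i))"
    using le by (intro summable_comparison_test[OF _ summ]) auto
  have "\<not> j * p dvd j" if "prime p" for p
    using j prime_gt_1_nat[OF that] by (auto dest: dvd_imp_le)
  then have jB: "{j} \<subseteq> B" unfolding B_def by auto
  have cover: "B \<subseteq> {j} \<union> {0} \<union> (\<Union>i. T i)"
  proof
    fix g assume g: "g \<in> B"
    show "g \<in> {j} \<union> {0} \<union> (\<Union>i. T i)"
    proof (cases "g = j \<or> g = 0")
      case False
      obtain h where h: "g = j * h" using g by (auto simp: B_def)
      with False have "h \<noteq> 1" by auto
      then obtain p where p: "prime p" "p dvd h" using prime_factor_nat by blast
      then have dvd: "j * p dvd g" unfolding h by simp
      have "p > N"
      proof (rule ccontr)
        assume "\<not> p > N"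
        with g p(1) dvd show False by (simp add: B_def)
      qed
      then have "p = Suc ((p - Suc N) + N)" by simp
      with dvd have "g \<in> T (p - Suc N)" unfolding T_def by (metis mem_Collect_eq)
      then show ?thesis by blast
    qed auto
  qed
  have "measure Q B \<le> measure Q ({j} \<union> {0} \<union> (\<Union>i. T i))"
    by (intro finite_measure_mono cover) (simp add: sets_Q)
  also have "\<dots> \<le> measure Q ({j} \<union> {0}) + measure Q (\<Union>i. T i)"
    by (intro measure_Un_le) (auto simp: sets_Q)
  also have "measure Q ({j} \<union> {0}) \<le> measure Q {j} + measure Q {0}"
    by (intro measure_Un_le) (auto simp: sets_Q)
  also have "measure Q (\<Union>i. T i) \<le> (\<Sum>i. measure Q (T i))"
    by (intro finite_measure_subadditive_countably summ_T) (simp add: sets_Q)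
  also have "\<dots> \<le> (\<Sum>i. K / real (Suc (i + N)) ^ 2)"
    by (intro suminf_le le summ_T summ)
  finally have "measure Q B - measure Q {j} \<le> (\<Sum>i. K / real (Suc (i + N)) ^ 2)"
    by (simp add: zero)
  moreover have "measure Q {j} \<le> measure Q B"
    by (intro finite_measure_mono jB) (simp add: sets_Q)
  ultimately show ?thesis unfolding B_def by simp
qed

text \<open>The criterion that serves both the gcd and the random product: divisibility
  probabilities close to \<open>m\<^sup>-\<^sup>d\<close>, with a uniform quadratic bound, force the masses of points
  towards the law with weights proportional to \<open>j\<^sup>-\<^sup>d\<close>. The limits in the sieve level \<open>N\<close>
  and in \<open>n\<close> can be interchanged since the sieve error is uniform in \<open>n\<close>. This yields the limit
  \<open>C * j\<^sup>-\<^sup>d\<close>, where \<open>C\<close> is the product of all \<open>1 - p\<^sup>-\<^sup>d\<close>. The value of \<open>C\<close> comes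
  from normalization: by Tannery's theorem no mass escapes to infinity, so the limiting masses add up to 1
  and \<open>C\<close> must be \<open>1 / \<zeta>(d)\<close>.\<close>

lemma zeta_law_limit:
  fixes Q :: "nat \<Rightarrow> nat measure" and d j :: nat and K :: real
  assumes prob: "\<And>n. prob_space (Q n)" and sets_Q: "\<And>n. sets (Q n) = UNIV"
    and zero: "\<And>n. measure (Q n) {0} = 0"
    and multiples: "\<And>m. m \<ge> 1 \<Longrightarrow> (\<lambda>n. measure (Q n) {g. m dvd g}) \<longlonglongrightarrow> 1 / real m ^ d"
    and bound: "\<And>m n. m \<ge> 1 \<Longrightarrow> measure (Q n) {g. m dvd g} \<le> K / real m ^ 2"
    and j: "j \<ge> 1"
  shows "(\<lambda>n. measure (Q n) {j}) \<longlonglongrightarrow> 1 / riemann_zeta (real d) * (1 / real j ^ d)"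
proof -
  define c where "c N = (\<Prod>p\<in>{p. prime p \<and> p \<le> N}. 1 - 1 / real p ^ d)" for N
  have fin: "finite {p::nat. prime p \<and> p \<le> N}" for N
    by (rule finite_subset[of _ "{..N}"]) auto
  have factor: "0 \<le> 1 - 1 / real p ^ d" "1 - 1 / real p ^ d \<le> 1" if "prime p" for p :: nat
    using prime_ge_1_nat[OF that] one_le_power[of "real p" d] by (simp_all add: divide_le_eq_1)
  have c_nonneg: "c N \<ge> 0" for N
    unfolding c_def by (intro prod_nonneg) (use factor in blast)
  have "c (Suc N) \<le> c N" for N
  proof (cases "prime (Suc N)")
    case True
    have eq: "{p. prime p \<and> p \<le> Suc N} = insert (Suc N) {p. prime p \<and> p \<le> N}"
      using True by (auto simp: le_Suc_eq)
    have "c (Suc N) = (1 - 1 / real (Suc N) ^ d) * c N"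
      unfolding c_def eq by (subst prod.insert) (auto simp: fin)
    also have "\<dots> \<le> 1 * c N"
      using factor[OF True] c_nonneg by (intro mult_right_mono) auto
    finally show ?thesis by simp
  next
    case False
    then have "{p. prime p \<and> p \<le> Suc N} = {p. prime p \<and> p \<le> N}"
      by (auto simp: le_Suc_eq)
    then show ?thesis by (simp add: c_def)
  qed
  then have "decseq c" by (rule decseq_SucI)
  then obtain C where C: "c \<longlonglongrightarrow> C"
    using decseq_convergent[of c 0] c_nonneg by blast
  have summ_K: "summable (\<lambda>i. K / real (Suc i) ^ 2)"
  proof -
    have "summable (\<lambda>i. inverse (real (Suc i) ^ 2))"
      using inverse_power_summable[of 2, where 'a=real] by (subst summable_Suc_iff) simp
    then show ?thesis by (auto simp: divide_inverse intro!: summable_mult)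
  qed
  have point: "(\<lambda>n. measure (Q n) {j}) \<longlonglongrightarrow> C / real j ^ d" if j: "j \<ge> 1" for j
  proof (rule swap_uniform_limit')
    show "\<forall>\<^sub>F N in sequentially.
        (\<lambda>n. measure (Q n) {g. j dvd g \<and> (\<forall>p\<in>{p. prime p \<and> p \<le> N}. \<not> j * p dvd g)})
          \<longlonglongrightarrow> c N / real j ^ d"
      unfolding c_def
      by (intro always_eventually allI sieved_multiples_limit prob sets_Q multiples fin j) auto
    show "(\<lambda>N. c N / real j ^ d) \<longlonglongrightarrow> C / real j ^ d"
      using C j by (intro tendsto_divide) auto
    show "uniform_limit UNIV
        (\<lambda>N n. measure (Q n) {g. j dvd g \<and> (\<forall>p\<in>{p. prime p \<and> p \<le> N}. \<not> j * p dvd g)})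
        (\<lambda>n. measure (Q n) {j}) sequentially"
    proof (rule uniform_limitI)
      fix e :: real assume "e > 0"
      from suminf_exist_split2[OF summ_K]
      have "(\<lambda>N. \<Sum>i. K / real (Suc (i + N)) ^ 2) \<longlonglongrightarrow> 0" .
      from order_tendstoD(2)[OF this \<open>e > 0\<close>]
      show "\<forall>\<^sub>F N in sequentially. \<forall>n\<in>UNIV.
          dist (measure (Q n) {g. j dvd g \<and> (\<forall>p\<in>{p. prime p \<and> p \<le> N}. \<not> j * p dvd g)})
            (measure (Q n) {j}) < e"
      proof eventually_elim
        case (elim N)
        show ?case
        proof
          fix n
          show "dist (measure (Q n) {g. j dvd g \<and> (\<forall>p\<in>{p. prime p \<and> p \<le> N}. \<not> j * p dvd g)})
            (measure (Q n) {j}) < e"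
            using sieve_error[OF prob[of n] sets_Q zero bound j, of N] elim
            unfolding dist_real_def by linarith
        qed
      qed
    qed
  qed auto
  have total: "(\<Sum>k. measure (Q n) {Suc k}) = 1" for n
  proof -
    interpret prob_space "Q n" by (rule prob)
    have sp: "space (Q n) = UNIV"
      using sets_Q[of n] sets.sets_into_space sets.top by (metis UNIV_I top.extremum_uniqueI)
    have "(\<lambda>k. measure (Q n) {Suc k}) sums measure (Q n) (\<Union>k. {Suc k})"
      by (intro measure_UNION) (auto simp: sets_Q disjoint_family_on_def)
    moreover have "measure (Q n) (\<Union>k. {Suc k}) = 1"
    proof -
      have "(\<Union>k. {Suc k}) = space (Q n) - {0}"
        using not0_implies_Suc by (auto simp: sp)
      then show ?thesis using prob_compl[of "{0}"] zero[of n] by (simp add: sets_Q)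
    qed
    ultimately show ?thesis by (simp add: sums_iff)
  qed
  have "summable (\<lambda>k. norm (C / real (Suc k) ^ d)) \<and>
      (\<lambda>n. \<Sum>k. measure (Q n) {Suc k}) \<longlonglongrightarrow> (\<Sum>k. C / real (Suc k) ^ d)"
  proof -
    have "measure (Q n) {Suc k} \<le> K / real (Suc k) ^ 2" for n k
    proof -
      interpret prob_space "Q n" by (rule prob)
      have "measure (Q n) {Suc k} \<le> measure (Q n) {g. Suc k dvd g}"
        by (intro finite_measure_mono) (auto simp: sets_Q)
      then show ?thesis using bound[of "Suc k" n] by simp
    qed
    with summ_K show ?thesis
      using tannerys_theorem[where a="\<lambda>k n. measure (Q n) {Suc k}" and F=sequentially
          and b="\<lambda>k. C / real (Suc k) ^ d" and M="\<lambda>i. K / real (Suc i) ^ 2",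
          OF point always_eventually]
      by (simp del: of_nat_Suc)
  qed
  then have summ: "summable (\<lambda>k. norm (C / real (Suc k) ^ d))"
    and lim: "(\<lambda>n::nat. 1) \<longlonglongrightarrow> (\<Sum>k. C / real (Suc k) ^ d)"
    unfolding total by (auto simp del: of_nat_Suc)
  have "(\<Sum>k. C / real (Suc k) ^ d) = 1" by (rule LIMSEQ_unique[OF lim tendsto_const])
  then have one: "(\<Sum>k. C * (1 / real (Suc k) ^ d)) = 1" by simp
  then have "C \<noteq> 0" by auto
  moreover have "summable (\<lambda>k. C * (1 / real (Suc k) ^ d))"
    using summable_norm_cancel[OF summ] by simp
  ultimately have "summable (\<lambda>k. 1 / real (Suc k) ^ d)"
    by (subst (asm) summable_cmult_iff) auto
  from suminf_mult[OF this, of C] one have "C * (\<Sum>k. 1 / real (Suc k) ^ d) = 1" by simp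
  moreover have "riemann_zeta (real d) = (\<Sum>k. 1 / real (Suc k) ^ d)"
    unfolding riemann_zeta_def by (simp add: powr_realpow del: of_nat_Suc)
  ultimately have "C = 1 / riemann_zeta (real d)"
    by (metis \<open>C \<noteq> 0\<close> mult_zero_right nonzero_eq_divide_eq zero_neq_one)
  with point[OF j] show ?thesis by simp
qed

text \<open>A distribution function of a law on the natural numbers is at each point a finite sum
  of point masses, so pointwise convergence of the masses is enough.\<close>

lemma weak_conv_m_nat:
  fixes P :: "nat \<Rightarrow> nat measure" and Q :: "nat measure"
  assumes P: "\<And>n. prob_space (P n)" "\<And>n. sets (P n) = UNIV"
    and Q: "prob_space Q" "sets Q = UNIV"
    and point: "\<And>j. (\<lambda>n. measure (P n) {j}) \<longlonglongrightarrow> measure Q {j}"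
  shows "weak_conv_m (\<lambda>n. distr (P n) borel real) (distr Q borel real)"
proof -
  have cdf: "cdf (distr R borel real) x = (\<Sum>j\<in>{j. real j \<le> x}. measure R {j})"
    if R: "prob_space R" "sets R = UNIV" for R x
  proof -
    interpret prob_space R by (rule R)
    have space: "space R = UNIV"
      using R(2) sets.sets_into_space[of UNIV R] by auto
    have real: "real \<in> measurable R borel"
      by (simp add: measurable_def R(2))
    have "{j. real j \<le> x} \<subseteq> {..nat \<lfloor>x\<rfloor>}" by (auto simp: le_nat_floor)
    then have fin: "finite {j. real j \<le> x}" by (rule finite_subset) simp
    have "cdf (distr R borel real) x = measure R {j. real j \<le> x}"
      unfolding cdf_def by (subst measure_distr[OF real]) (auto simp: space vimage_def)
    also have "\<dots> = (\<Sum>j\<in>{j. real j \<le> x}. measure R {j})"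
      by (rule finite_measure_eq_sum_singleton[OF fin]) (simp add: R(2))
    finally show ?thesis .
  qed
  show ?thesis
    unfolding weak_conv_m_def weak_conv_def
    by (simp add: cdf P Q point tendsto_sum)
qed

section \<open>Asymptotic equidistribution in residue classes\<close>

text \<open>When \<open>D n \<inter> B\<close> is translated by \<open>c\<close>, the points that leave \<open>D n\<close> lie in
  \<open>(D n + c) - D n\<close>, which is a vanishing proportion of \<open>D n\<close>. This gives one inequality; the other
  one is the same inequality for the translation by \<open>- c\<close>.\<close>

lemma shifted_density:
  fixes D :: "nat \<Rightarrow> 'a::ab_group_add set"
  assumes fin: "\<And>n. finite (D n)" and nonempty: "\<And>n. D n \<noteq> {}"
    and shift: "\<And>c. (\<lambda>n. real (card ((\<lambda>x. x + c) ` D n \<inter> D n)) / real (card (D n))) \<longlonglongrightarrow> 1"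
  shows "(\<lambda>n. real (card (D n \<inter> (\<lambda>x. x + c) ` B)) / real (card (D n))
            - real (card (D n \<inter> B)) / real (card (D n))) \<longlonglongrightarrow> 0"
proof -
  define s where "s c n = 1 - real (card ((\<lambda>x. x + c) ` D n \<inter> D n)) / real (card (D n))" for c n
  define \<delta> where "\<delta> B n = real (card (D n \<inter> B)) / real (card (D n))" for B n
  have s: "s c \<longlonglongrightarrow> 0" for c
    unfolding s_def using tendsto_diff[OF tendsto_const shift[of c], of 1] by simp
  have one_sided: "\<delta> B n - s c n \<le> \<delta> ((\<lambda>x. x + c) ` B) n" for B c n
  proof -
    have pos: "card (D n) > 0" using fin nonempty by (simp add: card_gt_0_iff)
    have inj: "inj_on (\<lambda>x. x + c) A" for A by (auto simp: inj_on_def)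
    have "(\<lambda>x. x + c) ` (D n \<inter> B) \<subseteq>
        (D n \<inter> (\<lambda>x. x + c) ` B) \<union> ((\<lambda>x. x + c) ` D n - D n)" by auto
    then have "card ((\<lambda>x. x + c) ` (D n \<inter> B)) \<le>
        card ((D n \<inter> (\<lambda>x. x + c) ` B) \<union> ((\<lambda>x. x + c) ` D n - D n))"
      by (intro card_mono) (auto simp: fin)
    also have "\<dots> \<le> card (D n \<inter> (\<lambda>x. x + c) ` B) + card ((\<lambda>x. x + c) ` D n - D n)"
      by (rule card_Un_le)
    finally have "card (D n \<inter> B) \<le> card (D n \<inter> (\<lambda>x. x + c) ` B) + card ((\<lambda>x. x + c) ` D n - D n)"
      by (simp add: card_image[OF inj])
    moreover have "card ((\<lambda>x. x + c) ` D n - D n) + card ((\<lambda>x. x + c) ` D n \<inter> D n) = card (D n)"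
      using card_Diff_subset_Int[of "(\<lambda>x. x + c) ` D n" "D n"]
        card_mono[of "(\<lambda>x. x + c) ` D n" "(\<lambda>x. x + c) ` D n \<inter> D n"] fin[of n]
      by (simp add: card_image[OF inj])
    ultimately have "real (card (D n \<inter> B)) + real (card ((\<lambda>x. x + c) ` D n \<inter> D n))
        \<le> real (card (D n \<inter> (\<lambda>x. x + c) ` B)) + real (card (D n))" by linarith
    then have "(real (card (D n \<inter> B)) + real (card ((\<lambda>x. x + c) ` D n \<inter> D n))) / real (card (D n))
        \<le> (real (card (D n \<inter> (\<lambda>x. x + c) ` B)) + real (card (D n))) / real (card (D n))"
      by (intro divide_right_mono) auto
    then show ?thesis
      using pos unfolding \<delta>_def s_def by (simp add: add_divide_distrib)
  qed
  have "\<bar>\<delta> ((\<lambda>x. x + c) ` B) n - \<delta> B n\<bar> \<le> \<bar>s c n\<bar> + \<bar>s (- c) n\<bar>" for n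
  proof -
    have "(\<lambda>x. x + - c) ` (\<lambda>x. x + c) ` B = B" by (simp add: image_image)
    then show ?thesis
      using one_sided[of B n c] one_sided[of "(\<lambda>x. x + c) ` B" n "- c"] by auto
  qed
  then have bound: "\<forall>n. norm (\<delta> ((\<lambda>x. x + c) ` B) n - \<delta> B n) \<le> \<bar>s c n\<bar> + \<bar>s (- c) n\<bar>" by simp
  have "(\<lambda>n. \<bar>s c n\<bar> + \<bar>s (- c) n\<bar>) \<longlonglongrightarrow> 0"
    using tendsto_add[OF tendsto_rabs_zero[OF s[of c]] tendsto_rabs_zero[OF s[of "- c"]]] by simp
  then have "(\<lambda>n. \<delta> ((\<lambda>x. x + c) ` B) n - \<delta> B n) \<longlonglongrightarrow> 0"
    by (rule Lim_null_comparison[OF always_eventually[OF bound]])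
  then show ?thesis unfolding \<delta>_def .
qed

lemma card_int_cube:
  "card {r :: int ^ 'd. \<forall>k. 0 \<le> r $ k \<and> r $ k < int m} = m ^ CARD('d)"
proof -
  have "bij_betw vec_nth {r :: int ^ 'd. \<forall>k. 0 \<le> r $ k \<and> r $ k < int m}
      (PiE UNIV (\<lambda>_. {0..<int m}))"
    by (rule bij_betwI[where g=vec_lambda]) (auto simp: PiE_def Pi_def)
  then have "card {r :: int ^ 'd. \<forall>k. 0 \<le> r $ k \<and> r $ k < int m}
      = card (PiE (UNIV :: 'd set) (\<lambda>_. {0..<int m}))" by (rule bij_betw_same_card)
  also have "\<dots> = m ^ CARD('d)" by (simp add: card_PiE)
  finally show ?thesis .
qed

text \<open>The \<open>m\<^sup>d\<close> cosets of the lattice of vectors divisible by \<open>m\<close> partition the space and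
  are translates of one another, so asymptotically they share the mass of \<open>D n\<close> equally.\<close>

lemma multiples_density:
  fixes D :: "nat \<Rightarrow> (int ^ 'd) set"
  assumes fin: "\<And>n. finite (D n)" and nonempty: "\<And>n. D n \<noteq> {}"
    and shift: "\<And>c. (\<lambda>n. real (card ((\<lambda>x. x + c) ` D n \<inter> D n)) / real (card (D n))) \<longlonglongrightarrow> 1"
    and m: "m \<ge> 1"
  shows "(\<lambda>n. real (card (D n \<inter> {x. \<forall>k. int m dvd x $ k})) / real (card (D n)))
           \<longlonglongrightarrow> 1 / real m ^ CARD('d)"
proof -
  define R where "R = {r :: int ^ 'd. \<forall>k. 0 \<le> r $ k \<and> r $ k < int m}"
  define L where "L = {x :: int ^ 'd. \<forall>k. int m dvd x $ k}"
  define \<delta> where "\<delta> B n = real (card (D n \<inter> B)) / real (card (D n))" for B n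
  have card_R: "card R = m ^ CARD('d)" unfolding R_def by (rule card_int_cube)
  have fin_R: "finite R" using card_R m by (intro card_ge_0_finite) simp
  have total: "(\<Sum>r\<in>R. \<delta> ((\<lambda>x. x + r) ` L) n) = 1" for n
  proof -
    have "D n = (\<Union>r\<in>R. D n \<inter> (\<lambda>x. x + r) ` L)"
    proof (intro equalityI subsetI)
      fix x assume x: "x \<in> D n"
      define r where "r = (\<chi> k. x $ k mod int m)"
      have "r \<in> R" using m by (auto simp: R_def r_def)
      moreover have "x - r \<in> L" by (auto simp: L_def r_def minus_mod_eq_mult_div)
      then have "x \<in> (\<lambda>x. x + r) ` L" by (intro image_eqI[of _ _ "x - r"]) auto
      ultimately show "x \<in> (\<Union>r\<in>R. D n \<inter> (\<lambda>x. x + r) ` L)" using x by auto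
    qed auto
    then have "card (D n) = card (\<Union>r\<in>R. D n \<inter> (\<lambda>x. x + r) ` L)" by simp
    also have "\<dots> = (\<Sum>r\<in>R. card (D n \<inter> (\<lambda>x. x + r) ` L))"
    proof (rule card_UN_disjoint[OF fin_R])
      show "\<forall>r\<in>R. \<forall>r'\<in>R. r \<noteq> r' \<longrightarrow>
          (D n \<inter> (\<lambda>x. x + r) ` L) \<inter> (D n \<inter> (\<lambda>x. x + r') ` L) = {}"
      proof (intro ballI impI, rule ccontr)
        fix r r' assume r: "r \<in> R" "r' \<in> R" "r \<noteq> r'"
          and "(D n \<inter> (\<lambda>x. x + r) ` L) \<inter> (D n \<inter> (\<lambda>x. x + r') ` L) \<noteq> {}"
        then obtain y z where yz: "y \<in> L" "z \<in> L" "y + r = z + r'" by auto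
        have "r $ k = r' $ k" for k
        proof -
          have e: "r $ k - r' $ k = z $ k - y $ k"
            using arg_cong[OF yz(3), of "\<lambda>v. v $ k"] by simp
          have "int m dvd r $ k - r' $ k"
            unfolding e using yz(1,2) by (auto simp: L_def)
          then have "r $ k mod int m = r' $ k mod int m" by (simp add: mod_eq_dvd_iff)
          then show ?thesis using r by (simp add: R_def)
        qed
        then show False using r by (simp add: vec_eq_iff)
      qed
    qed (simp add: fin)
    finally have "real (card (D n)) = (\<Sum>r\<in>R. real (card (D n \<inter> (\<lambda>x. x + r) ` L)))" by simp
    moreover have "card (D n) > 0" using fin nonempty by (simp add: card_gt_0_iff)
    ultimately show ?thesis unfolding \<delta>_def by (simp flip: sum_divide_distrib)
  qed
  have "(\<lambda>n. \<Sum>r\<in>R. \<delta> ((\<lambda>x. x + r) ` L) n - \<delta> L n) \<longlonglongrightarrow> (\<Sum>r\<in>R. 0)"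
    unfolding \<delta>_def by (intro tendsto_sum shifted_density fin nonempty shift)
  then have "(\<lambda>n. 1 - real (card R) * \<delta> L n) \<longlonglongrightarrow> 0"
    by (simp add: sum_subtractf total)
  then have "(\<lambda>n. (1 - (1 - real (card R) * \<delta> L n)) / real (card R)) \<longlonglongrightarrow> (1 - 0) / real (card R)"
    using card_R m by (intro tendsto_intros) auto
  then show ?thesis
    using m by (simp add: card_R \<delta>_def L_def)
qed

lemma dvd_gcd_vec_iff: "a dvd gcd_vec x \<longleftrightarrow> (\<forall>k. a dvd x $ k)"
  unfolding gcd_vec_def by (auto simp: dvd_Gcd_iff)

lemma gcd_vec_pos:
  assumes "x \<in> pos_lattice" shows "gcd_vec x > 0"
proof -
  have "gcd_vec x \<noteq> 0"
  proof
    assume "gcd_vec x = 0"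
    then have "x $ undefined = 0" using dvd_gcd_vec_iff[of 0 x] by simp
    moreover have "x $ undefined \<ge> 1" using assms by (simp add: pos_lattice_def)
    ultimately show False by simp
  qed
  moreover have "gcd_vec x \<ge> 0" by (simp add: gcd_vec_def)
  ultimately show ?thesis by simp
qed

lemma measure_uniformly_distributed:
  assumes X: "uniformly_distributed \<Omega> A X" and A: "finite A" "A \<noteq> {}"
  shows "measure (distr \<Omega> (count_space UNIV) (f \<circ> X)) B = real (card (A \<inter> f -` B)) / real (card A)"
proof -
  have X_meas: "X \<in> measurable \<Omega> (count_space UNIV)"
    and X_distr: "distr \<Omega> (count_space UNIV) X = measure_pmf (pmf_of_set A)"
    using X by (auto simp: uniformly_distributed_def)
  have "distr \<Omega> (count_space UNIV) (f \<circ> X)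
      = distr (distr \<Omega> (count_space UNIV) X) (count_space UNIV) f"
    using X_meas by (intro distr_distr[symmetric]) auto
  also have "measure \<dots> B = measure (measure_pmf (pmf_of_set A)) (f -` B)"
    unfolding X_distr by (subst measure_distr) auto
  also have "\<dots> = real (card (A \<inter> f -` B)) / real (card A)"
    by (rule measure_pmf_of_set[OF A(2,1)])
  finally show ?thesis .
qed

section \<open>The random product over the primes\<close>

lemma prime_product_eq_nat:
  fixes G :: "'d::finite \<Rightarrow> nat \<Rightarrow> 'w \<Rightarrow> nat"
  assumes fin: "finite {p. prime p \<and> (MIN k. G k p \<omega>) > 0}"
  obtains g where "convergent_prod (prime_power_factor G \<omega>)" "g > 0"
    "prime_product G \<omega> = real g"
    "\<And>p. prime p \<Longrightarrow> multiplicity p g = (MIN k. G k p \<omega>)"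
proof -
  (* The minimum is hidden behind a constant so that the simplifier does not turn comparisons
     with it into quantifiers over all coordinates. *)
  define \<mu> where "\<mu> p = (MIN k. G k p \<omega>)" for p
  define S where "S = {p. prime p \<and> \<mu> p > 0}"
  define g where "g = (\<Prod>p\<in>S. p ^ \<mu> p)"
  have factor: "prime_power_factor G \<omega> p = (if prime p then real p ^ \<mu> p else 1)" for p
    unfolding prime_power_factor_def \<mu>_def by (rule refl)
  have fin_S: "finite S" using fin unfolding S_def \<mu>_def .
  have one: "prime_power_factor G \<omega> p = 1" if "p \<notin> S" for p
    using that by (auto simp: factor S_def)
  show ?thesis
  proof
    show "convergent_prod (prime_power_factor G \<omega>)"
      using fin_S one by (rule convergent_prod_finite)
    show "g > 0" unfolding g_def by (intro prod_pos) (auto simp: S_def prime_gt_0_nat)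
    have "prime_product G \<omega> = (\<Prod>p\<in>S. prime_power_factor G \<omega> p)"
      unfolding prime_product_def using fin_S one by (rule prodinf_finite)
    also have "\<dots> = real g"
      by (auto simp: g_def S_def factor intro!: prod.cong)
    finally show "prime_product G \<omega> = real g" .
    show "multiplicity p g = (MIN k. G k p \<omega>)" if "prime p" for p
    proof -
      have "multiplicity p g = \<mu> p"
        unfolding g_def using that fin_S
        by (subst multiplicity_prod_prime_powers) (auto simp: S_def)
      then show ?thesis unfolding \<mu>_def .
    qed
  qed
qed

context prob_space begin

lemma geometric_array_measurable:
  fixes G :: "'d::finite \<Rightarrow> nat \<Rightarrow> 'a \<Rightarrow> nat"
  assumes G: "geometric_array G" and p: "prime p"
  shows "G k p \<in> measurable M (count_space UNIV)"
  using G p unfolding geometric_array_def indep_vars_def by auto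

lemma geometric_array_min_measurable:
  fixes G :: "'d::finite \<Rightarrow> nat \<Rightarrow> 'a \<Rightarrow> nat"
  assumes G: "geometric_array G" and p: "prime p"
  shows "(\<lambda>\<omega>. MIN k. G k p \<omega>) \<in> measurable M (count_space UNIV)"
proof -
  have [measurable]: "G k p \<in> measurable M (count_space UNIV)" for k
    by (rule geometric_array_measurable[OF G p])
  have "(\<lambda>\<omega>. MIN k. G k p \<omega>) -` {j} \<inter> space M
      = {\<omega>\<in>space M. (\<forall>k. j \<le> G k p \<omega>) \<and> \<not> (\<forall>k. Suc j \<le> G k p \<omega>)}" for j
  proof -
    have "(MIN k. G k p \<omega>) = j \<longleftrightarrow> j \<le> (MIN k. G k p \<omega>) \<and> \<not> Suc j \<le> (MIN k. G k p \<omega>)" for \<omega>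
      by linarith
    then show ?thesis by auto
  qed
  moreover have "{\<omega>\<in>space M. (\<forall>k. j \<le> G k p \<omega>) \<and> \<not> (\<forall>k. Suc j \<le> G k p \<omega>)} \<in> sets M" for j
    by measurable
  ultimately show ?thesis
    by (subst measurable_count_space_eq2_countable) auto
qed

text \<open>Where the random product converges, the event says that \<open>m\<close> divides it. It involves
  the finitely many independent variables \<open>G k p\<close> with \<open>p\<close> dividing \<open>m\<close>, and for each of the
  \<open>d\<close> indices \<open>k\<close> the factors \<open>p\<close> to the power \<open>- multiplicity p m\<close> multiply to \<open>1 / m\<close>.\<close>

lemma prob_geometric_array_ge_multiplicity:
  fixes G :: "'d::finite \<Rightarrow> nat \<Rightarrow> 'a \<Rightarrow> nat"
  assumes G: "geometric_array G" and m: "m \<ge> 1"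
  shows "prob {\<omega>\<in>space M. \<forall>p\<in>prime_factors m. multiplicity p m \<le> (MIN k. G k p \<omega>)}
           = 1 / real m ^ CARD('d)"
proof (cases "m = 1")
  case True
  then show ?thesis by (simp add: prob_space)
next
  case False
  define J where "J = (UNIV :: 'd set) \<times> prime_factors m"
  define A where "A = (\<lambda>(k::'d, p). {multiplicity p m..})"
  have ne: "prime_factors m \<noteq> {}"
    using False m prime_factor_nat[of m] by (auto simp: prime_factors_dvd)
  have "{\<omega>\<in>space M. \<forall>p\<in>prime_factors m. multiplicity p m \<le> (MIN k. G k p \<omega>)}
      = (\<Inter>i\<in>J. (\<lambda>(k, p). G k p) i -` A i \<inter> space M)"
    using ne by (auto simp: J_def A_def)
  then have "prob {\<omega>\<in>space M. \<forall>p\<in>prime_factors m. multiplicity p m \<le> (MIN k. G k p \<omega>)}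
      = prob (\<Inter>i\<in>J. (\<lambda>(k, p). G k p) i -` A i \<inter> space M)" by simp
  also have "\<dots> = (\<Prod>i\<in>J. prob ((\<lambda>(k, p). G k p) i -` A i \<inter> space M))"
  proof (rule indep_varsD)
    show "indep_vars (\<lambda>_. count_space UNIV) (\<lambda>(k, p). G k p) (UNIV \<times> {p. prime p})"
      using G by (simp add: geometric_array_def)
  qed (use ne in \<open>auto simp: J_def\<close>)
  also have "\<dots> = (\<Prod>i\<in>J. 1 / real (snd i) ^ multiplicity (snd i) m)"
  proof (rule prod.cong)
    fix i assume "i \<in> J"
    then obtain k p where i: "i = (k, p)" and "prime p" by (auto simp: J_def)
    have "(\<lambda>(k, p). G k p) i -` A i \<inter> space M = {\<omega>\<in>space M. G k p \<omega> \<ge> multiplicity p m}"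
      by (auto simp: i A_def)
    then show "prob ((\<lambda>(k, p). G k p) i -` A i \<inter> space M) = 1 / real (snd i) ^ multiplicity (snd i) m"
      using G \<open>prime p\<close> by (simp add: geometric_array_def i)
  qed simp
  also have "\<dots> = (\<Prod>k\<in>(UNIV::'d set). \<Prod>p\<in>prime_factors m. 1 / real p ^ multiplicity p m)"
    unfolding J_def prod.cartesian_product by (simp add: case_prod_unfold)
  also have "(\<Prod>p\<in>prime_factors m. 1 / real p ^ multiplicity p m)
      = 1 / real (\<Prod>p\<in>prime_factors m. p ^ multiplicity p m)"
    by (simp add: prod_dividef)
  also have "(\<Prod>p\<in>prime_factors m. p ^ multiplicity p m) = m"
    using m by (subst prod_prime_factors) auto
  finally show ?thesis by (simp add: power_divide)
qed

text \<open>By the Borel-Cantelli lemma, since the prime \<open>p\<close> contributes with probability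
  \<open>p\<^sup>-\<^sup>d\<close>, which is summable as \<open>d \<ge> 2\<close>.\<close>

lemma geometric_array_AE_finite:
  fixes G :: "'d::finite \<Rightarrow> nat \<Rightarrow> 'a \<Rightarrow> nat"
  assumes G: "geometric_array G" and d: "CARD('d) \<ge> 2"
  shows "AE \<omega> in M. finite {p. prime p \<and> (MIN k. G k p \<omega>) > 0}"
proof -
  define A where "A p = {\<omega>\<in>space M. prime p \<and> (MIN k. G k p \<omega>) > 0}" for p
  have meas: "A p \<in> sets M" for p
  proof (cases "prime p")
    case True
    have [measurable]: "(\<lambda>\<omega>. MIN k. G k p \<omega>) \<in> measurable M (count_space UNIV)"
      by (rule geometric_array_min_measurable[OF G True])
    show ?thesis unfolding A_def by measurable
  qed (simp add: A_def)
  have "prob (A p) \<le> inverse (real p ^ 2)" for p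
  proof (cases "prime p")
    case True
    have "prob (A p) = 1 / real p ^ CARD('d)"
      using prob_geometric_array_ge_multiplicity[OF G, of p] True
      by (simp add: prime_factorization_prime A_def Suc_le_eq prime_gt_0_nat)
    also have "\<dots> \<le> 1 / real p ^ 2"
      using d prime_ge_1_nat[OF True]
      by (intro divide_left_mono power_increasing) (auto simp: prime_gt_0_nat True)
    finally show ?thesis by (simp add: inverse_eq_divide)
  qed (simp add: A_def)
  then have "summable (\<lambda>p. prob (A p))"
    by (intro summable_comparison_test[OF _ inverse_power_summable[of 2]]) auto
  from borel_cantelli_AE1[OF meas _ this]
  have "AE \<omega> in M. \<forall>\<^sub>F p in sequentially. \<omega> \<in> space M - A p" by (simp add: emeasure_eq_measure)
  then show ?thesis
  proof (rule AE_mp, intro AE_I2 impI)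
    fix \<omega> assume \<omega>: "\<omega> \<in> space M" and "\<forall>\<^sub>F p in sequentially. \<omega> \<in> space M - A p"
    then obtain N where N: "\<And>p. p \<ge> N \<Longrightarrow> \<omega> \<notin> A p" by (auto simp: eventually_sequentially)
    have "{p. prime p \<and> (MIN k. G k p \<omega>) > 0} \<subseteq> {..<N}"
    proof
      fix p assume "p \<in> {p. prime p \<and> (MIN k. G k p \<omega>) > 0}"
      then have "\<omega> \<in> A p" using \<omega> unfolding A_def by blast
      then show "p \<in> {..<N}" using N[of p] by (meson lessThan_iff not_le)
    qed
    then show "finite {p. prime p \<and> (MIN k. G k p \<omega>) > 0}" by (rule finite_subset) simp
  qed
qed

text \<open>Measurability has to hold also where the product diverges. There the infinite
  product is one and the same description without a solution, hence a constant. Since all factors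
  are at least 1, convergence of the infinite product amounts to the Cauchy property of the
  partial products, which is a measurable condition.\<close>

lemma prime_product_measurable:
  fixes G :: "'d::finite \<Rightarrow> nat \<Rightarrow> 'a \<Rightarrow> nat"
  assumes G: "geometric_array G"
  shows "prime_product G \<in> borel_measurable M"
proof -
  define P where "P n \<omega> = (\<Prod>p\<le>n. prime_power_factor G \<omega> p)" for n \<omega>
  have factor: "(\<lambda>\<omega>. prime_power_factor G \<omega> p) \<in> borel_measurable M" for p
  proof (cases "prime p")
    case True
    have [measurable]: "(\<lambda>\<omega>. MIN k. G k p \<omega>) \<in> measurable M (count_space UNIV)"
      by (rule geometric_array_min_measurable[OF G True])
    show ?thesis unfolding prime_power_factor_def by measurable
  qed (simp add: prime_power_factor_def)
  have [measurable]: "P n \<in> borel_measurable M" for n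
    unfolding P_def using factor by measurable
  have ge1: "prime_power_factor G \<omega> p \<ge> 1" for \<omega> p
    using prime_ge_1_nat[of p] by (auto simp: prime_power_factor_def)
  then have nz: "prime_power_factor G \<omega> p \<noteq> 0" for \<omega> p
    by (metis not_one_le_zero)
  have conv: "convergent_prod (prime_power_factor G \<omega>) \<longleftrightarrow> Cauchy (\<lambda>n. P n \<omega>)" for \<omega>
  proof -
    have "lim (\<lambda>n. P n \<omega>) \<ge> 1" if "convergent (\<lambda>n. P n \<omega>)"
      using that unfolding convergent_LIMSEQ_iff
      by (rule LIMSEQ_le_const) (auto simp: P_def ge1 intro!: prod_ge_1)
    then show ?thesis
      unfolding Cauchy_convergent_iff
      using convergent_prod_iff_convergent[of "prime_power_factor G \<omega>", OF nz]
      by (force simp: P_def)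
  qed
  have "prime_product G \<omega> = (if Cauchy (\<lambda>n. P n \<omega>) then lim (\<lambda>n. P n \<omega>) else (THE p. False))" for \<omega>
  proof (cases "Cauchy (\<lambda>n. P n \<omega>)")
    case True
    then show ?thesis
      using prodinf_eq_lim[of "prime_power_factor G \<omega>", OF _ nz] conv[of \<omega>]
      by (simp add: prime_product_def P_def)
  next
    case False
    then have "(\<lambda>p. prime_power_factor G \<omega> has_prod p) = (\<lambda>p. False)"
      using conv[of \<omega>] by (simp add: has_prod_iff)
    with False show ?thesis by (simp add: prime_product_def prodinf_def)
  qed
  moreover have "(\<lambda>\<omega>. if Cauchy (\<lambda>n. P n \<omega>) then lim (\<lambda>n. P n \<omega>) else (THE p. False))
      \<in> borel_measurable M"
    by (intro measurable_If borel_measurable_lim_metric sets_Collect_Cauchy) measurable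
  ultimately show ?thesis by (simp cong: measurable_cong)
qed

end

text \<open>Almost surely the random product is a natural number whose prime factorization is
  given by the minima, so that its divisibility by \<open>m\<close> is an event about finitely many primes.
  The integer part provides a version \<open>g\<close> that is integer-valued everywhere and measurable.\<close>

lemma (in prob_space) prime_product_law:
  fixes G :: "'d::finite \<Rightarrow> nat \<Rightarrow> 'a \<Rightarrow> nat"
  assumes G: "geometric_array G" and d: "CARD('d) \<ge> 2"
  obtains g :: "'a \<Rightarrow> nat" where
    "g \<in> measurable M (count_space UNIV)"
    "AE \<omega> in M. convergent_prod (prime_power_factor G \<omega>) \<and> g \<omega> > 0 \<and> prime_product G \<omega> = real (g \<omega>)"
    "\<And>m. m \<ge> 1 \<Longrightarrow> prob {\<omega>\<in>space M. m dvd g \<omega>} = 1 / real m ^ CARD('d)"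
proof
  define g where "g \<omega> = nat \<lfloor>prime_product G \<omega>\<rfloor>" for \<omega>
  have [measurable]: "prime_product G \<in> borel_measurable M"
    by (rule prime_product_measurable[OF G])
  show g[measurable]: "g \<in> measurable M (count_space UNIV)"
    unfolding g_def by measurable
  have *: "convergent_prod (prime_power_factor G \<omega>) \<and> g \<omega> > 0 \<and> prime_product G \<omega> = real (g \<omega>) \<and>
      (\<forall>p. prime p \<longrightarrow> multiplicity p (g \<omega>) = (MIN k. G k p \<omega>))"
    if "finite {p. prime p \<and> (MIN k. G k p \<omega>) > 0}" for \<omega>
    using that
  proof (rule prime_product_eq_nat)
    fix h assume h: "convergent_prod (prime_power_factor G \<omega>)" "h > 0" "prime_product G \<omega> = real h"
      "\<And>p. prime p \<Longrightarrow> multiplicity p h = (MIN k. G k p \<omega>)"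
    moreover have "g \<omega> = h" by (simp add: g_def h(3))
    ultimately show ?thesis by simp
  qed
  note fin = geometric_array_AE_finite[OF G d]
  show "AE \<omega> in M. convergent_prod (prime_power_factor G \<omega>) \<and> g \<omega> > 0 \<and> prime_product G \<omega> = real (g \<omega>)"
    using fin by eventually_elim (use * in blast)
  show "prob {\<omega>\<in>space M. m dvd g \<omega>} = 1 / real m ^ CARD('d)" if m: "m \<ge> 1" for m
  proof -
    have [measurable]: "Measurable.pred M (\<lambda>\<omega>. multiplicity p m \<le> (MIN k. G k p \<omega>))"
      if "p \<in> prime_factors m" for p
    proof -
      have [measurable]: "(\<lambda>\<omega>. MIN k. G k p \<omega>) \<in> measurable M (count_space UNIV)"
        using that by (intro geometric_array_min_measurable[OF G]) auto
      show ?thesis by measurable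
    qed
    have "prob {\<omega>\<in>space M. m dvd g \<omega>}
        = prob {\<omega>\<in>space M. \<forall>p\<in>prime_factors m. multiplicity p m \<le> (MIN k. G k p \<omega>)}"
    proof (rule finite_measure_eq_AE)
      show "AE \<omega> in M. (\<omega> \<in> {\<omega>\<in>space M. m dvd g \<omega>}) =
          (\<omega> \<in> {\<omega>\<in>space M. \<forall>p\<in>prime_factors m. multiplicity p m \<le> (MIN k. G k p \<omega>)})"
        using fin
      proof eventually_elim
        case (elim \<omega>)
        have g: "g \<omega> > 0" and mult: "\<And>p. prime p \<Longrightarrow> multiplicity p (g \<omega>) = (MIN k. G k p \<omega>)"
          using *[OF elim] by blast+
        have "m dvd g \<omega> \<longleftrightarrow> (\<forall>p\<in>prime_factors m. multiplicity p m \<le> multiplicity p (g \<omega>))"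
        proof
          assume "m dvd g \<omega>"
          then show "\<forall>p\<in>prime_factors m. multiplicity p m \<le> multiplicity p (g \<omega>)"
            using g by (auto intro: dvd_imp_multiplicity_le)
        next
          assume le: "\<forall>p\<in>prime_factors m. multiplicity p m \<le> multiplicity p (g \<omega>)"
          show "m dvd g \<omega>"
          proof (rule multiplicity_le_imp_dvd)
            fix p :: nat assume p: "prime p"
            show "multiplicity p m \<le> multiplicity p (g \<omega>)"
              using le p by (cases "p dvd m") (use m in \<open>auto simp: prime_factors_dvd not_dvd_imp_multiplicity_0\<close>)
          qed (use m in auto)
        qed
        also have "\<dots> \<longleftrightarrow> (\<forall>p\<in>prime_factors m. multiplicity p m \<le> (MIN k. G k p \<omega>))"
          by (intro ball_cong refl) (use mult in \<open>simp add: in_prime_factors_imp_prime\<close>)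
        finally show ?case by blast
      qed
    qed measurable
    also have "\<dots> = 1 / real m ^ CARD('d)"
      by (rule prob_geometric_array_ge_multiplicity[OF G m])
    finally show ?thesis .
  qed
qed

section \<open>Convergence of the gcd\<close>

theorem corollary2p5:
  fixes D :: "nat \<Rightarrow> (int ^ 'd) set"
    and \<Omega> :: "nat \<Rightarrow> 'w measure"
    and X :: "nat \<Rightarrow> 'w \<Rightarrow> int ^ 'd"
    and M :: "'v measure"
    and G :: "'d \<Rightarrow> nat \<Rightarrow> 'v \<Rightarrow> nat"
  assumes d_ge_2: "CARD('d) \<ge> 2"
    and D_fin: "\<And>n. finite (D n)"
    and D_nonempty: "\<And>n. D n \<noteq> {}"
    and D_pos: "\<And>n. D n \<subseteq> pos_lattice"
    and D_shift: "\<And>c :: int ^ 'd.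
      (\<lambda>n. real (card ((\<lambda>x. x + c) ` D n \<inter> D n)) / real (card (D n))) \<longlonglongrightarrow> 1"
    and D_div: "\<exists>K > (0::real). \<forall>i j. i \<noteq> j \<longrightarrow>
      (\<forall>a \<ge> 1. \<forall>b \<ge> 1. \<forall>n.
        real (card (D n \<inter> div_lattice i a \<inter> div_lattice j b)) / real (card (D n))
          \<le> K / (real a * real b))"
    and Omega: "\<And>n. prob_space (\<Omega> n)"
    and X_unif: "\<And>n. uniformly_distributed (\<Omega> n) (D n) (X n)"
    and M: "prob_space M"
    and G: "prob_space.geometric_array M G"
  shows "(AE \<omega> in M. convergent_prod (prime_power_factor G \<omega>)) \<and>
    prime_product G \<in> borel_measurable M \<and>
    weak_conv_m
      (\<lambda>n. distr (\<Omega> n) borel (\<lambda>\<omega>. real_of_int (gcd_vec (X n \<omega>))))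
      (distr M borel (prime_product G)) \<and>
    (\<forall>j::nat. j \<ge> 1 \<longrightarrow>
      measure M {\<omega> \<in> space M. prime_product G \<omega> = real j}
        = 1 / riemann_zeta (real CARD('d)) * (1 / real j ^ CARD('d)))"
proof -
  interpret M: prob_space M by (rule M)
  obtain g where g_meas[measurable]: "g \<in> measurable M (count_space UNIV)"
    and g_AE: "AE \<omega> in M. convergent_prod (prime_power_factor G \<omega>) \<and> g \<omega> > 0 \<and> prime_product G \<omega> = real (g \<omega>)"
    and g_dvd: "\<And>m. m \<ge> 1 \<Longrightarrow> M.prob {\<omega>\<in>space M. m dvd g \<omega>} = 1 / real m ^ CARD('d)"
    using M.prime_product_law[OF G d_ge_2] by blast
  have prod_meas[measurable]: "prime_product G \<in> borel_measurable M"
    by (rule M.prime_product_measurable[OF G])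

  define Q where "Q = distr M (count_space UNIV) g"
  define f where "f x = nat (gcd_vec x)" for x :: "int ^ 'd"
  define P where "P n = distr (\<Omega> n) (count_space UNIV) (f \<circ> X n)" for n
  have X_meas: "X n \<in> measurable (\<Omega> n) (count_space UNIV)" for n
    using X_unif[of n] by (simp add: uniformly_distributed_def)
  have f_X_meas: "f \<circ> X n \<in> measurable (\<Omega> n) (count_space UNIV)" for n
    by (rule measurable_comp[OF X_meas]) simp

  have Q_prob: "prob_space Q" unfolding Q_def by (rule M.prob_space_distr[OF g_meas])
  have Q_sets: "sets Q = UNIV" by (simp add: Q_def)
  have Q_measure: "measure Q A = M.prob {\<omega>\<in>space M. g \<omega> \<in> A}" for A
    unfolding Q_def by (subst measure_distr) (auto intro: arg_cong[where f="measure M"])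
  have Q_zero: "measure Q {0} = 0"
  proof -
    have "M.prob {\<omega>\<in>space M. g \<omega> \<in> {0}} = 0"
      using g_AE by (intro M.prob_eq_0_AE) auto
    then show ?thesis by (simp add: Q_measure)
  qed
  have Q_dvd: "measure Q {k. m dvd k} = 1 / real m ^ CARD('d)" if "m \<ge> 1" for m
    using g_dvd[OF that] by (simp add: Q_measure)
  have Q_law: "measure Q {j} = 1 / riemann_zeta (real CARD('d)) * (1 / real j ^ CARD('d))"
    if "j \<ge> 1" for j
  proof -
    (* The law of the random product satisfies the criterion as a constant sequence. *)
    have "(\<lambda>n::nat. measure Q {j}) \<longlonglongrightarrow> 1 / riemann_zeta (real CARD('d)) * (1 / real j ^ CARD('d))"
    proof (rule zeta_law_limit[where K=1])
      show "measure Q {k. m dvd k} \<le> 1 / real m ^ 2" if "m \<ge> 1" for m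
        unfolding Q_dvd[OF that] using that d_ge_2
        by (intro divide_left_mono power_increasing) auto
    qed (use Q_prob Q_sets Q_zero Q_dvd that in auto)
    then show ?thesis by (rule LIMSEQ_unique[OF tendsto_const])
  qed

  have P_prob: "prob_space (P n)" for n
    unfolding P_def by (rule prob_space.prob_space_distr[OF Omega f_X_meas])
  have P_sets: "sets (P n) = UNIV" for n by (simp add: P_def)
  have P_measure: "measure (P n) A = real (card (D n \<inter> f -` A)) / real (card (D n))" for n A
    unfolding P_def by (rule measure_uniformly_distributed[OF X_unif D_fin D_nonempty])
  have gcd_pos: "gcd_vec x > 0" if "x \<in> D n" for x n
    using gcd_vec_pos D_pos that by blast
  have P_zero: "measure (P n) {0} = 0" for n
  proof -
    have "D n \<inter> f -` {0} = {}" using gcd_pos by (fastforce simp: f_def)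
    then show ?thesis by (simp add: P_measure)
  qed
  have dvd_f: "m dvd f x \<longleftrightarrow> (\<forall>k. int m dvd x $ k)" for m x
  proof -
    have "gcd_vec x \<ge> 0" by (simp add: gcd_vec_def)
    then have "int (f x) = gcd_vec x" by (simp add: f_def)
    then show ?thesis by (metis dvd_gcd_vec_iff int_dvd_int_iff)
  qed
  then have vimage_dvd: "f -` {k. m dvd k} = {x. \<forall>k. int m dvd x $ k}" for m by auto
  have P_dvd: "(\<lambda>n. measure (P n) {k. m dvd k}) \<longlonglongrightarrow> 1 / real m ^ CARD('d)" if "m \<ge> 1" for m
    unfolding P_measure vimage_dvd by (rule multiples_density[OF D_fin D_nonempty D_shift that])
  obtain K where K: "\<And>i j a b n. i \<noteq> j \<Longrightarrow> a \<ge> 1 \<Longrightarrow> b \<ge> 1 \<Longrightarrow>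
      real (card (D n \<inter> div_lattice i a \<inter> div_lattice j b)) / real (card (D n)) \<le> K / (real a * real b)"
    using D_div by blast
  obtain i i' :: 'd where "i \<noteq> i'"
    using d_ge_2 by (metis card_2_iff' ex_card UNIV_I)
  (* Two distinct coordinates suffice: both are divisible by m whenever the gcd is. *)
  have P_bound: "measure (P n) {k. m dvd k} \<le> K / real m ^ 2" if "m \<ge> 1" for m n
  proof -
    have "card (D n \<inter> {x. \<forall>k. int m dvd x $ k}) \<le> card (D n \<inter> div_lattice i m \<inter> div_lattice i' m)"
      by (intro card_mono) (auto simp: D_fin div_lattice_def)
    then have "measure (P n) {k. m dvd k}
        \<le> real (card (D n \<inter> div_lattice i m \<inter> div_lattice i' m)) / real (card (D n))"
      unfolding P_measure vimage_dvd by (intro divide_right_mono) auto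
    also have "\<dots> \<le> K / real m ^ 2"
      using K[OF \<open>i \<noteq> i'\<close> that that, of n] by (simp add: power2_eq_square)
    finally show ?thesis .
  qed
  have P_lim: "(\<lambda>n. measure (P n) {j}) \<longlonglongrightarrow> measure Q {j}" for j
  proof (cases "j \<ge> 1")
    case True
    show ?thesis
      unfolding Q_law[OF True]
      by (rule zeta_law_limit[OF P_prob P_sets P_zero P_dvd P_bound True])
  next
    case False
    then have "j = 0" by simp
    then show ?thesis by (simp add: P_zero Q_zero)
  qed

  have "distr (P n) borel real = distr (\<Omega> n) borel (\<lambda>\<omega>. real_of_int (gcd_vec (X n \<omega>)))" for n
  proof -
    have "distr (P n) borel real = distr (\<Omega> n) borel (real \<circ> (f \<circ> X n))"
      unfolding P_def by (rule distr_distr[OF _ f_X_meas]) simp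
    moreover have "real \<circ> (f \<circ> X n) = (\<lambda>\<omega>. real_of_int (gcd_vec (X n \<omega>)))"
      by (auto simp: f_def gcd_vec_def)
    ultimately show ?thesis by simp
  qed
  moreover have "distr Q borel real = distr M borel (prime_product G)"
  proof -
    have "distr Q borel real = distr M borel (\<lambda>\<omega>. real (g \<omega>))"
      unfolding Q_def by (subst distr_distr) (auto simp: comp_def)
    also have "\<dots> = distr M borel (prime_product G)"
    proof (rule distr_cong_AE)
      show "AE \<omega> in M. real (g \<omega>) = prime_product G \<omega>"
        using g_AE by eventually_elim simp
    qed (simp_all, measurable)
    finally show ?thesis .
  qed
  ultimately have "weak_conv_m
      (\<lambda>n. distr (\<Omega> n) borel (\<lambda>\<omega>. real_of_int (gcd_vec (X n \<omega>))))
      (distr M borel (prime_product G))"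
    using weak_conv_m_nat[OF P_prob P_sets Q_prob Q_sets P_lim] by simp
  moreover have "measure M {\<omega> \<in> space M. prime_product G \<omega> = real j}
        = 1 / riemann_zeta (real CARD('d)) * (1 / real j ^ CARD('d))" if "j \<ge> 1" for j :: nat
  proof -
    have "measure M {\<omega> \<in> space M. prime_product G \<omega> = real j} = M.prob {\<omega>\<in>space M. g \<omega> \<in> {j}}"
    proof (rule M.finite_measure_eq_AE)
      show "AE \<omega> in M. (\<omega> \<in> {\<omega> \<in> space M. prime_product G \<omega> = real j})
          = (\<omega> \<in> {\<omega>\<in>space M. g \<omega> \<in> {j}})"
        using g_AE by eventually_elim simp
      show "{\<omega> \<in> space M. prime_product G \<omega> = real j} \<in> sets M"
        by (rule borel_measurable_eq[OF prod_meas borel_measurable_const])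
      show "{\<omega>\<in>space M. g \<omega> \<in> {j}} \<in> sets M"
        using measurable_sets[OF g_meas, of "{j}"] by (simp add: vimage_def Int_def conj_commute)
    qed
    then show ?thesis using Q_law[OF that] by (simp add: Q_measure)
  qed
  moreover have "AE \<omega> in M. convergent_prod (prime_power_factor G \<omega>)"
    using g_AE by eventually_elim simp
  ultimately show ?thesis using prod_meas by blast
qed

end
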